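(* Let $n\in\mathbb{N}$, $a,b\in\mathbb{R}$, $c\in\mathbb{R}\setminus\{0\}$, $L\in\mathbb{R}$, and let $$f_{\infty,L}(y_1,y_2)=g(y_1,y_2)^{\frac{1}{2(n+1)}(1-nL)}\,h(y_1,y_2)^{\frac{1}{2(n+1)}(1+nL)},$$ where $$g(y_1,y_2)=c(y_1-a)^{n+1}+i(n+1)(y_2-b),\qquad h(y_1,y_2)=c(y_1-a)^{n+1}-i(n+1)(y_2-b).$$ Then $f_{\infty,L}$ is a smooth solution (smooth on $\mathbb{G}_n\setminus\{(a,b)\}$) to the Dirichlet problem $$\begin{cases}\mathcal{G}_{\infty,L}f_{\infty,L}(q)=0, & q\in\mathbb{G}_n\setminus\{(a,b)\},\\ f_{\infty,L}(q)=0, & q=(a,b),\end{cases}$$ where $$\mathcal{G}_{\infty,L}(f)=\Delta_\infty f+iL\,\left([Y_1,Y_2]\|\nabla_0f\|_{\mathbb{G}}^2\right)f.$$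
   Context: The Grushin-type plane $\mathbb{G}_n$ (with parameters $a\in\mathbb{R}$, $c\in\mathbb{R}\setminus\{0\}$, $n\in\mathbb{N}$) is $\mathbb{R}^2$ with coordinates $(y_1,y_2)$ and the vector fields $$Y_1=\frac{\partial}{\partial y_1},\qquad Y_2=c(y_1-a)^n\frac{\partial}{\partial y_2},\qquad [Y_1,Y_2]=cn(y_1-a)^{n-1}\frac{\partial}{\partial y_2}.$$ A (singular) inner product on $\mathbb{R}^2$, with norm $\|\cdot\|_{\mathbb{G}}$, is chosen so that $\{Y_1,Y_2\}$ is orthonormal. The horizontal gradient is $\nabla_0f=(Y_1f,Y_2f)$; for complex-valued $f$, $\|\nabla_0f\|_{\mathbb{G}}^2=Y_1f\,\overline{Y_1f}+Y_2f\,\overline{Y_2f}$. The $\infty$-Laplacian is $$\Delta_\infty f=\left(Y_1\|\nabla_0f\|_{\mathbb{G}}^2\right)Y_1f+\left(Y_2\|\nabla_0f\|_{\mathbb{G}}^2\right)Y_2f.$$ The value of $f_{\infty,L}$ at $(a,b)$ is understood as its limit there.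
   Formalization: For even n and nL/(n+1) not an integer no continuous single-valued f exists on G_n minus (a,b); f is read as any continuous determination of the product of powers on an open set avoiding (a,b), with a global one shown to exist when n is odd or nL/(n+1) is an integer. *)

theory Defs
  imports "HOL-Analysis.Analysis"
begin

(* C^k on an open set: all iterated directional derivatives up to order k exist
   and are continuous.  Only meant for open U, since derivatives are taken at x. *)
primrec Ck_on :: "nat \<Rightarrow> ('v::real_normed_vector \<Rightarrow> 'w::real_normed_vector) \<Rightarrow> 'v set \<Rightarrow> bool" where
  "Ck_on 0 f U \<longleftrightarrow> continuous_on U f"
| "Ck_on (Suc k) f U \<longleftrightarrow> (\<forall>x\<in>U. f differentiable (at x)) \<and>
     (\<forall>v. Ck_on k (\<lambda>x. frechet_derivative f (at x) v) U)"

definition smooth_on :: "('v::real_normed_vector \<Rightarrow> 'w::real_normed_vector) \<Rightarrow> 'v set \<Rightarrow> bool" where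
  "smooth_on f U \<longleftrightarrow> (\<forall>k. Ck_on k f U)"

(* A vector field on the plane is given by its coefficients with respect to d/dy1, d/dy2. *)
type_synonym vfield = "real \<times> real \<Rightarrow> real \<times> real"

definition vf_apply :: "vfield \<Rightarrow> (real \<times> real \<Rightarrow> 'w::real_normed_vector) \<Rightarrow> real \<times> real \<Rightarrow> 'w" where
  "vf_apply X f q = frechet_derivative f (at q) (X q)"

(* The field of the commutator f |-> X (Y f) - Y (X f), in coordinates. *)
definition lie_bracket :: "vfield \<Rightarrow> vfield \<Rightarrow> vfield" where
  "lie_bracket X Y q = vf_apply X Y q - vf_apply Y X q"

definition Y1 :: vfield where
  "Y1 q = (1, 0)"

definition Y2 :: "real \<Rightarrow> real \<Rightarrow> nat \<Rightarrow> vfield" where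
  "Y2 a c n q = (0, c * (fst q - a) ^ n)"

lemma lie_bracket_Y1_Y2:
  "lie_bracket Y1 (Y2 a c n) q = (0, c * real n * (fst q - a) ^ (n - 1))"
proof -
  have Y1: "(Y1 has_derivative (\<lambda>v. 0)) (at q)"
    unfolding Y1_def by (rule has_derivative_const)
  have Y2: "(Y2 a c n has_derivative
      (\<lambda>v. (0, c * (real n * fst v * (fst q - a) ^ (n - 1))))) (at q)"
    unfolding Y2_def
    by (auto intro!: derivative_eq_intros simp: fun_eq_iff algebra_simps)
  show ?thesis
    using frechet_derivative_at[OF Y1, symmetric] frechet_derivative_at[OF Y2, symmetric]
    by (simp add: lie_bracket_def vf_apply_def Y1_def)
qed

(* Components with respect to the orthonormal frame (Y1, Y2). *)
definition hgrad :: "real \<Rightarrow> real \<Rightarrow> nat \<Rightarrow> (real \<times> real \<Rightarrow> complex) \<Rightarrow> real \<times> real \<Rightarrow> complex \<times> complex" where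
  "hgrad a c n f q = (vf_apply Y1 f q, vf_apply (Y2 a c n) f q)"

definition hgrad_norm_sq :: "real \<Rightarrow> real \<Rightarrow> nat \<Rightarrow> (real \<times> real \<Rightarrow> complex) \<Rightarrow> real \<times> real \<Rightarrow> complex" where
  "hgrad_norm_sq a c n f q =
     fst (hgrad a c n f q) * cnj (fst (hgrad a c n f q)) +
     snd (hgrad a c n f q) * cnj (snd (hgrad a c n f q))"

definition inf_Laplacian :: "real \<Rightarrow> real \<Rightarrow> nat \<Rightarrow> (real \<times> real \<Rightarrow> complex) \<Rightarrow> real \<times> real \<Rightarrow> complex" where
  "inf_Laplacian a c n f q =
     vf_apply Y1 (hgrad_norm_sq a c n f) q * vf_apply Y1 f q +
     vf_apply (Y2 a c n) (hgrad_norm_sq a c n f) q * vf_apply (Y2 a c n) f q"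

definition G_inf :: "real \<Rightarrow> real \<Rightarrow> nat \<Rightarrow> real \<Rightarrow> (real \<times> real \<Rightarrow> complex) \<Rightarrow> real \<times> real \<Rightarrow> complex" where
  "G_inf a c n L f q =
     inf_Laplacian a c n f q +
     \<i> * of_real L * vf_apply (lie_bracket Y1 (Y2 a c n)) (hgrad_norm_sq a c n f) q * f q"

definition g_fun :: "real \<Rightarrow> real \<Rightarrow> real \<Rightarrow> nat \<Rightarrow> real \<times> real \<Rightarrow> complex" where
  "g_fun a b c n q =
     of_real (c * (fst q - a) ^ (n + 1)) + \<i> * of_real (real (n + 1) * (snd q - b))"

definition h_fun :: "real \<Rightarrow> real \<Rightarrow> real \<Rightarrow> nat \<Rightarrow> real \<times> real \<Rightarrow> complex" where
  "h_fun a b c n q =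
     of_real (c * (fst q - a) ^ (n + 1)) - \<i> * of_real (real (n + 1) * (snd q - b))"

definition g_exponent :: "nat \<Rightarrow> real \<Rightarrow> real" where
  "g_exponent n L = 1 / (2 * real (n + 1)) * (1 - real n * L)"

definition h_exponent :: "nat \<Rightarrow> real \<Rightarrow> real" where
  "h_exponent n L = 1 / (2 * real (n + 1)) * (1 + real n * L)"

(* All values of the multivalued power z^s, for z \<noteq> 0 (no values for z = 0). *)
definition power_values :: "complex \<Rightarrow> complex \<Rightarrow> complex set" where
  "power_values z s = {exp (s * w) | w. exp w = z}"

definition f_inf_values ::
  "real \<Rightarrow> real \<Rightarrow> real \<Rightarrow> nat \<Rightarrow> real \<Rightarrow> real \<times> real \<Rightarrow> complex set" where
  "f_inf_values a b c n L q =
     {u * v | u v. u \<in> power_values (g_fun a b c n q) (of_real (g_exponent n L)) \<and>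
                   v \<in> power_values (h_fun a b c n q) (of_real (h_exponent n L))}"

(* f = g^(...) h^(...) involves non-integral complex powers.  On the plane without (a,b) no
   continuous single-valued determination need exist: for even n, g winds once around 0 along
   a loop around (a,b), and the product picks up the factor exp (-2 pi i n L / (n + 1)).
   So f is read as a continuous determination of the product on an open set U. *)
definition f_inf_branch ::
  "real \<Rightarrow> real \<Rightarrow> real \<Rightarrow> nat \<Rightarrow> real \<Rightarrow> (real \<times> real) set \<Rightarrow> (real \<times> real \<Rightarrow> complex) \<Rightarrow> bool" where
  "f_inf_branch a b c n L U f \<longleftrightarrow>
     continuous_on U f \<and> (\<forall>q\<in>U. f q \<in> f_inf_values a b c n L q)"

(* The determination with principal powers; discontinuous across the half-lines where g < 0. *)
definition f_inf :: "real \<Rightarrow> real \<Rightarrow> real \<Rightarrow> nat \<Rightarrow> real \<Rightarrow> real \<times> real \<Rightarrow> complex" where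
  "f_inf a b c n L q =
     g_fun a b c n q powr of_real (g_exponent n L) *
     h_fun a b c n q powr of_real (h_exponent n L)"

end

theory Submission
  imports Defs
begin

text \<open>Write \<open>X = y\<^sub>1 - a\<close>, \<open>Y = y\<^sub>2 - b\<close> and \<open>s\<close>, \<open>t\<close> for the exponents of \<open>g\<close> and \<open>h\<close>. Near a point every
  continuous determination \<open>f\<close> is a constant times a product of principal powers, so that
  \<open>df = f (s dg / g + t dh / h)\<close>; smoothness follows by iterating this equation. Since \<open>h\<close> is the conjugate
  of \<open>g\<close> and \<open>s + t = 1 / (n + 1)\<close>, the modulus of \<open>f\<close> is \<open>P\<close> to the power \<open>1 / (2 (n + 1))\<close>, where
  \<open>P = g h = c\<^sup>2 X\<^sup>2\<^sup>n\<^sup>+\<^sup>2 + (n + 1)\<^sup>2 Y\<^sup>2\<close>. Hence the squared norm of the horizontal gradient is real, a constant times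
  \<open>X\<^sup>2\<^sup>n\<close> times \<open>P\<close> to the power \<open>- n / (n + 1)\<close>, and the equation reduces to an identity between
  polynomials in \<open>X\<close> and \<open>Y\<close>.\<close>

section \<open>Calculus of \<open>Ck_on\<close> and \<open>smooth_on\<close> on open sets\<close>

text \<open>On an open set, equality of values forces equality of derivatives at each point. The
  induction varies both functions because its hypothesis is applied to their directional
  derivatives.\<close>

lemma Ck_on_cong:
  assumes "open U" "\<And>x. x \<in> U \<Longrightarrow> f x = g x" "Ck_on k f U"
  shows "Ck_on k g U"
  using assms(2,3)
proof (induction k arbitrary: f g)
  case 0
  then show ?case by (simp cong: continuous_on_cong)
next
  case (Suc k)
  have D: "(g has_derivative frechet_derivative f (at x)) (at x)" if "x \<in> U" for x
  proof -
    have "(f has_derivative frechet_derivative f (at x)) (at x)"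
      using Suc.prems that frechet_derivative_works by auto
    then show ?thesis
      by (rule has_derivative_transform_within_open) (use Suc.prems(1) assms(1) that in auto)
  qed
  show ?case
    unfolding Ck_on.simps
  proof (intro conjI ballI allI)
    show "g differentiable (at x)" if "x \<in> U" for x
      using D[OF that] differentiableI by blast
    show "Ck_on k (\<lambda>x. frechet_derivative g (at x) v) U" for v
    proof (rule Suc.IH)
      show "Ck_on k (\<lambda>x. frechet_derivative f (at x) v) U"
        using Suc.prems by simp
      show "frechet_derivative f (at x) v = frechet_derivative g (at x) v" if "x \<in> U" for x
        using frechet_derivative_at[OF D[OF that]] by simp
    qed
  qed
qed

text \<open>Lets an explicit derivative \<open>F\<close> stand in for
  \<open>frechet_derivative\<close>; every later regularity proof enters through this rule or a
  consequence of it.\<close>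

lemma Ck_on_SucI:
  assumes "open U" "\<And>x. x \<in> U \<Longrightarrow> (f has_derivative F x) (at x)"
    and "\<And>v. Ck_on k (\<lambda>x. F x v) U"
  shows "Ck_on (Suc k) f U"
  unfolding Ck_on.simps
proof (intro conjI ballI allI)
  show "f differentiable (at x)" if "x \<in> U" for x
    using assms(2)[OF that] differentiableI by blast
  show "Ck_on k (\<lambda>x. frechet_derivative f (at x) v) U" for v
    by (rule Ck_on_cong[OF assms(1) _ assms(3)[of v]])
       (use frechet_derivative_at[OF assms(2)] in simp)
qed

text \<open>The recursion for \<open>Suc k\<close> speaks only of derivatives. Differentiability
  supplies the continuity at the bottom, and each further order follows from the one below.\<close>

lemma Ck_on_SucD:
  assumes "Ck_on (Suc k) f U"
  shows "Ck_on k f U"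
  using assms
proof (induction k arbitrary: f)
  case 0
  then show ?case
    by (auto intro!: differentiable_imp_continuous_on differentiable_at_imp_differentiable_on)
next
  case (Suc k)
  then show ?case by (subst Ck_on.simps) (subst (asm) (2) Ck_on.simps, blast)
qed

lemma Ck_on_const: "Ck_on k (\<lambda>x. c) U"
  by (induction k arbitrary: c) (simp_all add: frechet_derivative_const)

lemma Ck_on_add:
  assumes "open U" "Ck_on k f U" "Ck_on k g U"
  shows "Ck_on k (\<lambda>x. f x + g x) U"
  using assms(2,3)
proof (induction k arbitrary: f g)
  case 0
  then show ?case by (simp add: continuous_on_add)
next
  case (Suc k)
  show ?case
  proof (rule Ck_on_SucI[OF assms(1)])
    show "((\<lambda>x. f x + g x) has_derivative
        (\<lambda>v. frechet_derivative f (at x) v + frechet_derivative g (at x) v)) (at x)" if "x \<in> U" for x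
      using Suc.prems that by (auto intro!: has_derivative_add simp: frechet_derivative_works)
    show "Ck_on k (\<lambda>x. frechet_derivative f (at x) v + frechet_derivative g (at x) v) U" for v
      using Suc by simp
  qed
qed

lemma Ck_on_mult:
  fixes f g :: "'v::real_normed_vector \<Rightarrow> 'w::real_normed_algebra"
  assumes "open U" "Ck_on k f U" "Ck_on k g U"
  shows "Ck_on k (\<lambda>x. f x * g x) U"
  using assms(2,3)
proof (induction k arbitrary: f g)
  case 0
  then show ?case by (simp add: continuous_on_mult)
next
  case (Suc k)
  show ?case
  proof (rule Ck_on_SucI[OF assms(1)])
    show "((\<lambda>x. f x * g x) has_derivative
        (\<lambda>v. f x * frechet_derivative g (at x) v + frechet_derivative f (at x) v * g x)) (at x)"
      if "x \<in> U" for x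
      using Suc.prems that by (auto intro!: has_derivative_mult simp: frechet_derivative_works)
    \<comment> \<open>The undifferentiated factors in the product rule are given with order
      \<open>Suc k\<close>, so one order is dropped before the induction hypothesis applies.\<close>
    show "Ck_on k (\<lambda>x. f x * frechet_derivative g (at x) v + frechet_derivative f (at x) v * g x) U" for v
      using Suc.prems Ck_on_SucD[of k f U] Ck_on_SucD[of k g U]
      by (intro Ck_on_add[OF assms(1)] Suc.IH) simp_all
  qed
qed

lemma smooth_on_const: "smooth_on (\<lambda>x. c) U"
  by (simp add: smooth_on_def Ck_on_const)

lemma smooth_on_add:
  "open U \<Longrightarrow> smooth_on f U \<Longrightarrow> smooth_on g U \<Longrightarrow> smooth_on (\<lambda>x. f x + g x) U"
  by (simp add: smooth_on_def Ck_on_add)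

lemma smooth_on_mult:
  fixes f g :: "'v::real_normed_vector \<Rightarrow> 'w::real_normed_algebra"
  shows "open U \<Longrightarrow> smooth_on f U \<Longrightarrow> smooth_on g U \<Longrightarrow> smooth_on (\<lambda>x. f x * g x) U"
  by (simp add: smooth_on_def Ck_on_mult)

lemma smooth_on_power:
  fixes f :: "'v::real_normed_vector \<Rightarrow> 'w::real_normed_algebra_1"
  shows "open U \<Longrightarrow> smooth_on f U \<Longrightarrow> smooth_on (\<lambda>x. f x ^ n) U"
  by (induction n) (simp_all add: smooth_on_const smooth_on_mult)

lemma smooth_onI_derivative:
  assumes "open U" "\<And>x. x \<in> U \<Longrightarrow> (f has_derivative F x) (at x)"
    and "\<And>v. smooth_on (\<lambda>x. F x v) U"
  shows "smooth_on f U"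
  unfolding smooth_on_def
proof
  fix k
  have "Ck_on (Suc k) f U"
    using assms by (intro Ck_on_SucI[of U f F]) (auto simp: smooth_on_def)
  then show "Ck_on k f U"
    by (rule Ck_on_SucD)
qed

text \<open>Bootstrapping: if \<open>f\<close> is of class \<open>k\<close>, so is its derivative
  \<open>f * R v\<close>, hence \<open>f\<close> is of class \<open>k + 1\<close>. No formula for
  higher derivatives is needed.\<close>

lemma smooth_on_logarithmic_derivative:
  fixes f :: "'v::real_normed_vector \<Rightarrow> 'w::real_normed_algebra"
  assumes "open U" "\<And>x. x \<in> U \<Longrightarrow> (f has_derivative (\<lambda>v. f x * R v x)) (at x)"
    and "\<And>v. smooth_on (R v) U"
  shows "smooth_on f U"
  unfolding smooth_on_def
proof
  show "Ck_on k f U" for k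
  proof (induction k)
    case 0
    show ?case
      using assms(2) by (auto intro!: continuous_at_imp_continuous_on has_derivative_continuous)
  next
    case (Suc k)
    show ?case
      using Suc assms(3)
      by (intro Ck_on_SucI[OF assms(1,2)] Ck_on_mult[OF assms(1)]) (auto simp: smooth_on_def)
  qed
qed

text \<open>The same bootstrapping: the derivative of \<open>1 / f\<close> is built from
  \<open>1 / f\<close> itself and the derivative of \<open>f\<close>.\<close>

lemma smooth_on_inverse:
  fixes f :: "'v::real_normed_vector \<Rightarrow> 'w::real_normed_field"
  assumes "open U" "smooth_on f U" "\<And>x. x \<in> U \<Longrightarrow> f x \<noteq> 0"
  shows "smooth_on (\<lambda>x. inverse (f x)) U"
  unfolding smooth_on_def
proof
  have f: "Ck_on (Suc k) f U" for k
    using assms(2) by (simp only: smooth_on_def)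
  show "Ck_on k (\<lambda>x. inverse (f x)) U" for k
  proof (induction k)
    case 0
    show ?case
      using f[of 0] assms(3) Ck_on_SucD[of 0 f U] by (auto intro!: continuous_on_inverse)
  next
    case (Suc k)
    show ?case
    proof (rule Ck_on_SucI[OF assms(1)])
      show "((\<lambda>x. inverse (f x)) has_derivative
          (\<lambda>v. (- 1) * (inverse (f x) * (frechet_derivative f (at x) v * inverse (f x))))) (at x)"
        if "x \<in> U" for x
      proof -
        have "(f has_derivative frechet_derivative f (at x)) (at x)"
          using f[of 0] that frechet_derivative_works by auto
        from Deriv.has_derivative_inverse[OF assms(3)[OF that] this] show ?thesis
          by (simp add: mult.assoc)
      qed
      show "Ck_on k (\<lambda>x. (- 1) * (inverse (f x) * (frechet_derivative f (at x) v * inverse (f x)))) U" for v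
        using Suc f[of k] by (intro Ck_on_mult[OF assms(1)] Ck_on_const) simp_all
    qed
  qed
qed

section \<open>The functions \<open>g\<close> and \<open>h\<close> and their differentials\<close>

lemma h_fun_eq_cnj: "h_fun a b c n q = cnj (g_fun a b c n q)"
  by (simp add: h_fun_def g_fun_def)

lemma g_fun_eq_0_iff: "c \<noteq> 0 \<Longrightarrow> g_fun a b c n q = 0 \<longleftrightarrow> q = (a, b)"
  by (cases q) (auto simp: g_fun_def complex_eq_iff simp del: of_nat_Suc)

lemma h_fun_eq_0_iff: "c \<noteq> 0 \<Longrightarrow> h_fun a b c n q = 0 \<longleftrightarrow> q = (a, b)"
  by (simp add: h_fun_eq_cnj g_fun_eq_0_iff)

text \<open>The direction \<open>v\<close> precedes the point \<open>q\<close>, so that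
  \<open>dg a c n v\<close> is a function of the point. The body is kept as sums and products of
  simple factors to match the closure rules for \<open>smooth_on\<close>.\<close>

definition dg :: "real \<Rightarrow> real \<Rightarrow> nat \<Rightarrow> real \<times> real \<Rightarrow> real \<times> real \<Rightarrow> complex" where
  "dg a c n v q = of_real (real (n + 1) * fst v) * (of_real c * of_real (fst q - a) ^ n)
     + \<i> * of_real (real (n + 1) * snd v)"

definition dh :: "real \<Rightarrow> real \<Rightarrow> nat \<Rightarrow> real \<times> real \<Rightarrow> real \<times> real \<Rightarrow> complex" where
  "dh a c n v q = of_real (real (n + 1) * fst v) * (of_real c * of_real (fst q - a) ^ n)
     - \<i> * of_real (real (n + 1) * snd v)"

lemma has_derivative_g_fun: "(g_fun a b c n has_derivative (\<lambda>v. dg a c n v q)) (at q)"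
  unfolding g_fun_def dg_def
  by (rule derivative_eq_intros refl)+ (simp add: fun_eq_iff algebra_simps)

lemma has_derivative_h_fun: "(h_fun a b c n has_derivative (\<lambda>v. dh a c n v q)) (at q)"
  unfolding h_fun_def dh_def
  by (rule derivative_eq_intros refl)+ (simp add: fun_eq_iff algebra_simps)

lemma smooth_on_of_real_fst_minus:
  assumes "open U"
  shows "smooth_on (\<lambda>q::real \<times> real. complex_of_real (fst q - a)) U"
proof (rule smooth_onI_derivative[OF assms])
  show "((\<lambda>q::real \<times> real. complex_of_real (fst q - a)) has_derivative (\<lambda>v. of_real (fst v))) (at q)" for q
    by (auto intro!: derivative_eq_intros)
qed (rule smooth_on_const)

lemma smooth_on_dg: "open U \<Longrightarrow> smooth_on (dg a c n v) U"
  unfolding dg_def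
  by (intro smooth_on_add smooth_on_mult smooth_on_power smooth_on_const smooth_on_of_real_fst_minus)

lemma smooth_on_dh: "open U \<Longrightarrow> smooth_on (dh a c n v) U"
  unfolding dh_def diff_conv_add_uminus
  by (intro smooth_on_add smooth_on_mult smooth_on_power smooth_on_const
      smooth_on_of_real_fst_minus[unfolded diff_conv_add_uminus])

lemma smooth_on_g_fun: "open U \<Longrightarrow> smooth_on (g_fun a b c n) U"
  by (rule smooth_onI_derivative[OF _ has_derivative_g_fun smooth_on_dg])

lemma smooth_on_h_fun: "open U \<Longrightarrow> smooth_on (h_fun a b c n) U"
  by (rule smooth_onI_derivative[OF _ has_derivative_h_fun smooth_on_dh])

lemma continuous_on_g_fun: "continuous_on S (g_fun a b c n)"
  unfolding g_fun_def by (intro continuous_intros)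

lemma continuous_on_h_fun: "continuous_on S (h_fun a b c n)"
  unfolding h_fun_def by (intro continuous_intros)

section \<open>Local determinations: normal form, derivative and smoothness\<close>

text \<open>Dividing by the value at \<open>p\<close> moves the cut of \<open>Ln\<close> away from
  \<open>p\<close>. As \<open>h\<close> is the conjugate of \<open>g\<close>, the same set keeps the
  quotient of \<open>h\<close> off the cut.\<close>

definition local_dom :: "real \<Rightarrow> real \<Rightarrow> real \<Rightarrow> nat \<Rightarrow> real \<times> real \<Rightarrow> (real \<times> real) set" where
  "local_dom a b c n p = {q. g_fun a b c n q / g_fun a b c n p \<notin> \<real>\<^sub>\<le>\<^sub>0}"

text \<open>The determination of the product of powers of \<open>g / g(p)\<close> and
  \<open>h / h(p)\<close> that equals 1 at \<open>p\<close>. Being a product of exponentials it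
  never vanishes, so division by it is harmless.\<close>

definition local_branch ::
  "real \<Rightarrow> real \<Rightarrow> real \<Rightarrow> nat \<Rightarrow> real \<Rightarrow> real \<times> real \<Rightarrow> real \<times> real \<Rightarrow> complex" where
  "local_branch a b c n L p q =
     exp (of_real (g_exponent n L) * Ln (g_fun a b c n q / g_fun a b c n p)) *
     exp (of_real (h_exponent n L) * Ln (h_fun a b c n q / h_fun a b c n p))"

lemma open_local_dom: 
  assumes "c \<noteq> 0" "p \<noteq> (a, b)"
  shows "open (local_dom a b c n p)"
proof -
  have "open ((\<lambda>q. g_fun a b c n q / g_fun a b c n p) -` (- \<real>\<^sub>\<le>\<^sub>0))"
    by (intro open_vimage continuous_intros continuous_on_g_fun)
       (use assms in \<open>auto simp: g_fun_eq_0_iff\<close>)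
  then show ?thesis by (simp add: local_dom_def vimage_def)
qed

lemma center_in_local_dom: "c \<noteq> 0 \<Longrightarrow> p \<noteq> (a, b) \<Longrightarrow> p \<in> local_dom a b c n p"
  by (simp add: local_dom_def g_fun_eq_0_iff)

lemma singular_notin_local_dom: "c \<noteq> 0 \<Longrightarrow> (a, b) \<notin> local_dom a b c n p"
  using g_fun_eq_0_iff[of c a b n "(a, b)"] by (simp add: local_dom_def)

lemma cnj_nonpos_Reals_iff: "cnj z \<in> \<real>\<^sub>\<le>\<^sub>0 \<longleftrightarrow> z \<in> \<real>\<^sub>\<le>\<^sub>0"
  by (simp add: complex_nonpos_Reals_iff)

lemma h_quotient_local_dom:
  "q \<in> local_dom a b c n p \<Longrightarrow> h_fun a b c n q / h_fun a b c n p \<notin> \<real>\<^sub>\<le>\<^sub>0"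
  using cnj_nonpos_Reals_iff[of "g_fun a b c n q / g_fun a b c n p"]
  by (simp add: local_dom_def h_fun_eq_cnj)

lemma local_branch_center: "c \<noteq> 0 \<Longrightarrow> p \<noteq> (a, b) \<Longrightarrow> local_branch a b c n L p p = 1"
  by (simp add: local_branch_def g_fun_eq_0_iff h_fun_eq_0_iff)

lemma local_branch_nonzero: "local_branch a b c n L p q \<noteq> 0"
  by (simp add: local_branch_def)

lemma continuous_on_local_branch:
  assumes "c \<noteq> 0" "p \<noteq> (a, b)"
  shows "continuous_on (local_dom a b c n p) (local_branch a b c n L p)"
  unfolding local_branch_def
  using assms h_quotient_local_dom[of _ a b c n p]
  by (intro continuous_intros continuous_on_g_fun continuous_on_h_fun)
     (auto simp: g_fun_eq_0_iff h_fun_eq_0_iff local_dom_def)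

text \<open>At the center both logarithms are taken at 1 and both exponentials at 0, so no power
  survives in the derivative.\<close>

lemma has_derivative_local_branch:
  assumes "c \<noteq> 0" "p \<noteq> (a, b)"
  shows "(local_branch a b c n L p has_derivative
     (\<lambda>v. of_real (g_exponent n L) * dg a c n v p / g_fun a b c n p
        + of_real (h_exponent n L) * dh a c n v p / h_fun a b c n p)) (at p)"
proof -
  \<comment> \<open>The derivative of a single factor, used for \<open>k = g\<close> and for
    \<open>k = h\<close>.\<close>
  have E: "((\<lambda>q. exp (of_real s * Ln (k q / k p))) has_derivative
      (\<lambda>v. of_real s * k' v / k p)) (at p)"
    if k: "(k has_derivative k') (at p)" "k p \<noteq> 0" for k :: "real \<times> real \<Rightarrow> complex" and k' s
  proof -
    have L: "((\<lambda>w. exp (of_real s * Ln (w / k p))) has_field_derivative of_real s / k p) (at (k p))"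
      using that(2) by (auto intro!: derivative_eq_intros)
    show ?thesis
      using has_derivative_compose[OF k(1) L[unfolded has_field_derivative_def]]
      by (simp add: mult.commute)
  qed
  have nz: "g_fun a b c n p \<noteq> 0" "h_fun a b c n p \<noteq> 0"
    using assms by (simp_all add: g_fun_eq_0_iff h_fun_eq_0_iff)
  show ?thesis
    unfolding local_branch_def
    using has_derivative_mult[OF E[OF has_derivative_g_fun nz(1)] E[OF has_derivative_h_fun nz(2)]] nz
    by (simp add: add.commute)
qed

text \<open>Adding \<open>Ln (g q / g p)\<close> to a logarithm of \<open>g p\<close> gives a
  logarithm of \<open>g q\<close>, and likewise for \<open>h\<close>. So \<open>local_branch\<close>
  carries values at \<open>p\<close> to values at \<open>q\<close>.\<close>

lemma local_branch_times_value:
  assumes "c \<noteq> 0" "p \<noteq> (a, b)" "q \<noteq> (a, b)" "z \<in> f_inf_values a b c n L p"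
  shows "z * local_branch a b c n L p q \<in> f_inf_values a b c n L q"
proof -
  let ?g = "g_fun a b c n" and ?h = "h_fun a b c n"
  obtain w w' where w: "exp w = ?g p" "exp w' = ?h p"
    and z: "z = exp (of_real (g_exponent n L) * w) * exp (of_real (h_exponent n L) * w')"
    using assms(4) by (auto simp: f_inf_values_def power_values_def)
  have "exp (w + Ln (?g q / ?g p)) = ?g q" "exp (w' + Ln (?h q / ?h p)) = ?h q"
    using assms w by (simp_all add: exp_add g_fun_eq_0_iff h_fun_eq_0_iff)
  moreover have "z * local_branch a b c n L p q =
      exp (of_real (g_exponent n L) * (w + Ln (?g q / ?g p))) *
      exp (of_real (h_exponent n L) * (w' + Ln (?h q / ?h p)))"
    by (simp add: z local_branch_def distrib_left exp_add)
  ultimately show ?thesis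
    unfolding f_inf_values_def power_values_def by blast
qed

text \<open>The transport back from \<open>q\<close> to \<open>p\<close>: the same logarithms are
  subtracted.\<close>

lemma value_divide_local_branch:
  assumes "c \<noteq> 0" "p \<noteq> (a, b)" "q \<noteq> (a, b)" "z \<in> f_inf_values a b c n L q"
  shows "z / local_branch a b c n L p q \<in> f_inf_values a b c n L p"
proof -
  let ?g = "g_fun a b c n" and ?h = "h_fun a b c n"
  obtain w w' where w: "exp w = ?g q" "exp w' = ?h q"
    and z: "z = exp (of_real (g_exponent n L) * w) * exp (of_real (h_exponent n L) * w')"
    using assms(4) by (auto simp: f_inf_values_def power_values_def)
  have "exp (w - Ln (?g q / ?g p)) = ?g p" "exp (w' - Ln (?h q / ?h p)) = ?h p"
    using assms w by (simp_all add: exp_diff g_fun_eq_0_iff h_fun_eq_0_iff)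
  moreover have "z / local_branch a b c n L p q =
      exp (of_real (g_exponent n L) * (w - Ln (?g q / ?g p))) *
      exp (of_real (h_exponent n L) * (w' - Ln (?h q / ?h p)))"
    by (simp add: z local_branch_def right_diff_distrib exp_diff)
  ultimately show ?thesis
    unfolding f_inf_values_def power_values_def by blast
qed

text \<open>The logarithms of a nonzero number differ by integer multiples of
  \<open>2 * pi * \<i>\<close>.\<close>

lemma countable_power_values: "countable (power_values z s)"
proof -
  have "{w. exp w = z} \<subseteq> range (\<lambda>k::int. Ln z + of_int (2 * k) * of_real pi * \<i>)"
    if "z \<noteq> 0"
    using that exp_eq[of _ "Ln z"] by auto
  then have "countable {w. exp w = z}"
    by (cases "z = 0") (simp, rule countable_subset, auto)
  moreover have "power_values z s = (\<lambda>w. exp (s * w)) ` {w. exp w = z}"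
    by (auto simp: power_values_def)
  ultimately show ?thesis by simp
qed

lemma countable_f_inf_values: "countable (f_inf_values a b c n L q)"
proof -
  have "f_inf_values a b c n L q = (\<lambda>(u, v). u * v) `
      (power_values (g_fun a b c n q) (of_real (g_exponent n L)) \<times>
       power_values (h_fun a b c n q) (of_real (h_exponent n L)))"
    by (auto simp: f_inf_values_def)
  then show ?thesis by (simp add: countable_power_values)
qed

text \<open>A connected set with two distinct points in a metric space is uncountable. Countability
  is used in place of discreteness, since for irrational exponents the values of the product need
  not form a discrete set.\<close>

lemma continuous_countable_range_constant:
  fixes f :: "'a::topological_space \<Rightarrow> 'b::metric_space"
  assumes "connected S" "continuous_on S f" "countable (f ` S)" "x \<in> S" "y \<in> S"
  shows "f x = f y"
  using connected_uncountable[OF connected_continuous_image[OF assms(2,1)], of "f x" "f y"] assms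
  by auto

text \<open>A determination divided by \<^const>\<open>local_branch\<close> is continuous with values in the countable
  set of all values of the product at \<open>p\<close>, hence constant near \<open>p\<close>.\<close>
lemma f_inf_branch_local:
  assumes c: "c \<noteq> 0" and U: "open U" "(a, b) \<notin> U" and f: "f_inf_branch a b c n L U f" and p: "p \<in> U"
  obtains V where "open V" "p \<in> V" "\<And>q. q \<in> V \<Longrightarrow> f q = f p * local_branch a b c n L p q"
proof -
  let ?l = "local_branch a b c n L p" and ?D = "local_dom a b c n p"
  have pab: "p \<noteq> (a, b)" using U p by auto
  have "open (U \<inter> ?D)" "p \<in> U \<inter> ?D"
    using open_Int[OF U(1) open_local_dom[OF c pab]] p center_in_local_dom[OF c pab] by auto
  \<comment> \<open>A ball serves as the neighbourhood because it is connected.\<close>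
  then obtain e where e: "e > 0" "ball p e \<subseteq> U \<inter> ?D"
    using open_contains_ball by metis
  have "continuous_on (ball p e) (\<lambda>q. f q / ?l q)"
    using e(2) f continuous_on_local_branch[OF c pab] local_branch_nonzero
    by (intro continuous_on_divide) (auto simp: f_inf_branch_def intro: continuous_on_subset)
  moreover have "(\<lambda>q. f q / ?l q) ` ball p e \<subseteq> f_inf_values a b c n L p"
  proof
    fix z assume "z \<in> (\<lambda>q. f q / ?l q) ` ball p e"
    then obtain q where q: "q \<in> U" "z = f q / ?l q" using e(2) by auto
    then show "z \<in> f_inf_values a b c n L p"
      using value_divide_local_branch[OF c pab, of q "f q"] f U by (auto simp: f_inf_branch_def)
  qed
  then have "countable ((\<lambda>q. f q / ?l q) ` ball p e)"
    using countable_f_inf_values by (rule countable_subset)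
  ultimately have *: "f q / ?l q = f p / ?l p" if "q \<in> ball p e" for q
    using that e(1)
    by (intro continuous_countable_range_constant[where S = "ball p e"]) auto
  show ?thesis
  proof
    show "f q = f p * ?l q" if "q \<in> ball p e" for q
      using *[OF that] local_branch_nonzero[of a b c n L p q] c pab
      by (simp add: local_branch_center field_simps)
  qed (use e in auto)
qed

text \<open>Each point \<open>p\<close> of \<open>U\<close> uses the local branch centered at
  itself, so the derivative of \<open>local_branch\<close> at its center, multiplied by the constant
  \<open>f p\<close>, suffices.\<close>

lemma f_inf_branch_has_derivative:
  assumes "c \<noteq> 0" "open U" "(a, b) \<notin> U" "f_inf_branch a b c n L U f" "p \<in> U"
  shows "(f has_derivative (\<lambda>v. f p *
     (of_real (g_exponent n L) * dg a c n v p / g_fun a b c n p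
        + of_real (h_exponent n L) * dh a c n v p / h_fun a b c n p))) (at p)"
proof -
  obtain V where V: "open V" "p \<in> V" "\<And>q. q \<in> V \<Longrightarrow> f q = f p * local_branch a b c n L p q"
    using f_inf_branch_local[OF assms] by blast
  have "p \<noteq> (a, b)" using assms by auto
  from has_derivative_mult_right[OF has_derivative_local_branch[OF assms(1) this], of "f p" n L]
  show ?thesis
    using V(1,2) by (rule has_derivative_transform_within_open) (rule V(3)[symmetric])
qed

lemma f_inf_branch_smooth:
  assumes "c \<noteq> 0" "open U" "(a, b) \<notin> U" "f_inf_branch a b c n L U f"
  shows "smooth_on f U"
proof (rule smooth_on_logarithmic_derivative[OF assms(2) f_inf_branch_has_derivative[OF assms]])
  have nz: "g_fun a b c n q \<noteq> 0" "h_fun a b c n q \<noteq> 0" if "q \<in> U" for q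
    using that assms by (auto simp: g_fun_eq_0_iff h_fun_eq_0_iff)
  show "smooth_on (\<lambda>q. of_real (g_exponent n L) * dg a c n v q / g_fun a b c n q
        + of_real (h_exponent n L) * dh a c n v q / h_fun a b c n q) U" for v
    unfolding divide_inverse using assms(2) nz
    by (intro smooth_on_add smooth_on_mult smooth_on_inverse smooth_on_const
        smooth_on_dg smooth_on_dh smooth_on_g_fun smooth_on_h_fun) auto
qed

section \<open>The modulus of the values and the limit at the singular point\<close>

lemma g_exponent_plus_h_exponent: "g_exponent n L + h_exponent n L = 1 / real (n + 1)"
  unfolding g_exponent_def h_exponent_def distrib_left[symmetric] by (simp del: distrib_left_numeral of_nat_add)

lemma h_exponent_minus_g_exponent: "h_exponent n L - g_exponent n L = real n * L / real (n + 1)"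
  unfolding g_exponent_def h_exponent_def right_diff_distrib[symmetric] by (simp del: distrib_left_numeral of_nat_add)

text \<open>The exponents are real, so moduli depend only on the real parts of the logarithms. These
  agree for \<open>g\<close> and \<open>h\<close>, and the exponents add up to
  \<open>1 / (n + 1)\<close>; the modulus is thus the same for all values.\<close>

lemma norm_f_inf_value:
  assumes "z \<in> f_inf_values a b c n L q"
  shows "norm z = norm (g_fun a b c n q) powr (1 / real (n + 1))"
proof -
  obtain w w' where w: "exp w = g_fun a b c n q" "exp w' = h_fun a b c n q"
    and z: "z = exp (of_real (g_exponent n L) * w) * exp (of_real (h_exponent n L) * w')"
    using assms by (auto simp: f_inf_values_def power_values_def)
  have e: "exp (Re w) = norm (g_fun a b c n q)" "exp (Re w') = norm (g_fun a b c n q)"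
    using w by (simp_all flip: norm_exp_eq_Re add: h_fun_eq_cnj)
  then have re: "Re w' = Re w"
    by (metis exp_inj_iff)
  show ?thesis
    using g_exponent_plus_h_exponent[of n L]
    by (simp add: z norm_mult e(1)[symmetric] re powr_def flip: exp_add distrib_right)
qed

text \<open>The modulus of \<open>f\<close> is the modulus of \<open>g\<close> to the positive power
  \<open>1 / (n + 1)\<close>, and \<open>g\<close> tends to 0 at \<open>(a, b)\<close>.\<close>

lemma f_inf_branch_tendsto_0:
  assumes "f_inf_branch a b c n L U f"
  shows "(f \<longlongrightarrow> 0) (at (a, b) within U)"
proof -
  have "((\<lambda>q. norm (g_fun a b c n q) powr (1 / real (n + 1))) \<longlongrightarrow>
      norm (g_fun a b c n (a, b)) powr (1 / real (n + 1))) (at (a, b) within U)"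
    using continuous_on_g_fun[of UNIV a b c n]
    by (intro tendsto_intros) (auto intro: tendsto_within_subset simp: continuous_on_def)
  then have "((\<lambda>q. norm (g_fun a b c n q) powr (1 / real (n + 1))) \<longlongrightarrow> 0) (at (a, b) within U)"
    by (simp add: g_fun_def)
  moreover have ev: "\<forall>\<^sub>F q in at (a, b) within U. norm (f q) = norm (g_fun a b c n q) powr (1 / real (n + 1))"
    using assms by (auto simp: f_inf_branch_def eventually_at_filter norm_f_inf_value intro!: always_eventually)
  ultimately have "((\<lambda>q. norm (f q)) \<longlongrightarrow> 0) (at (a, b) within U)"
    unfolding tendsto_cong[OF ev] by blast
  then show ?thesis by (rule tendsto_norm_zero_cancel)
qed


section \<open>The horizontal gradient, its squared norm and the equation\<close>

definition g_norm_sq :: "real \<Rightarrow> real \<Rightarrow> real \<Rightarrow> nat \<Rightarrow> real \<times> real \<Rightarrow> real" where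
  "g_norm_sq a b c n q = (c * (fst q - a) ^ (n + 1))\<^sup>2 + (real (n + 1) * (snd q - b))\<^sup>2"

lemma norm_g_fun_sq: "(norm (g_fun a b c n q))\<^sup>2 = g_norm_sq a b c n q"
  by (simp only: cmod_power2 g_norm_sq_def) (simp add: g_fun_def)

lemma g_fun_times_h_fun: "g_fun a b c n q * h_fun a b c n q = of_real (g_norm_sq a b c n q)"
  by (simp only: h_fun_eq_cnj complex_norm_square[symmetric] norm_g_fun_sq[symmetric])

lemma g_norm_sq_pos: "c \<noteq> 0 \<Longrightarrow> q \<noteq> (a, b) \<Longrightarrow> g_norm_sq a b c n q > 0"
  by (simp flip: norm_g_fun_sq add: g_fun_eq_0_iff)

text \<open>Closed form of the squared norm of the horizontal gradient, common to all determinations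
  and real-valued. The last exponent is \<open>- n / (n + 1)\<close>.\<close>

definition f_hgrad_norm_sq :: "real \<Rightarrow> real \<Rightarrow> real \<Rightarrow> nat \<Rightarrow> real \<Rightarrow> real \<times> real \<Rightarrow> real" where
  "f_hgrad_norm_sq a b c n L q = 2 * ((g_exponent n L)\<^sup>2 + (h_exponent n L)\<^sup>2) * (real (n + 1) * c)\<^sup>2 *
     (fst q - a) ^ (2 * n) * g_norm_sq a b c n q powr (1 / real (n + 1) - 1)"

lemma vf_apply_eq: "(f has_derivative F) (at q) \<Longrightarrow> vf_apply X f q = F (X q)"
  by (simp add: vf_apply_def frechet_derivative_at[symmetric])

text \<open>Relations of Cauchy-Riemann type: \<open>Y2 g = \<i> * Y1 g\<close> and
  \<open>Y2 h = - \<i> * Y1 h\<close>. They are the source of the common factor in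
  \<open>Y1 f\<close> and \<open>Y2 f\<close>.\<close>

lemma dg_Y1: "dg a c n (Y1 q) q = of_real (real (n + 1) * c * (fst q - a) ^ n)"
  and dh_Y1: "dh a c n (Y1 q) q = of_real (real (n + 1) * c * (fst q - a) ^ n)"
  and dg_Y2: "dg a c n (Y2 a c n q) q = \<i> * of_real (real (n + 1) * c * (fst q - a) ^ n)"
  and dh_Y2: "dh a c n (Y2 a c n q) q = - \<i> * of_real (real (n + 1) * c * (fst q - a) ^ n)"
  by (simp_all add: dg_def dh_def Y1_def Y2_def)

lemma f_inf_branch_Y1:
  assumes "c \<noteq> 0" "open U" "(a, b) \<notin> U" "f_inf_branch a b c n L U f" "q \<in> U"
  shows "vf_apply Y1 f q = f q * of_real (real (n + 1) * c * (fst q - a) ^ n) *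
     (of_real (g_exponent n L) / g_fun a b c n q + of_real (h_exponent n L) / h_fun a b c n q)"
  unfolding vf_apply_eq[OF f_inf_branch_has_derivative[OF assms]] dg_Y1 dh_Y1
  by (simp only: divide_inverse ring_distribs mult_ac mult_minus_left mult_minus_right diff_conv_add_uminus)

lemma f_inf_branch_Y2:
  assumes "c \<noteq> 0" "open U" "(a, b) \<notin> U" "f_inf_branch a b c n L U f" "q \<in> U"
  shows "vf_apply (Y2 a c n) f q = \<i> * f q * of_real (real (n + 1) * c * (fst q - a) ^ n) *
     (of_real (g_exponent n L) / g_fun a b c n q - of_real (h_exponent n L) / h_fun a b c n q)"
  unfolding vf_apply_eq[OF f_inf_branch_has_derivative[OF assms]] dg_Y2 dh_Y2
  by (simp only: divide_inverse ring_distribs mult_ac mult_minus_left mult_minus_right diff_conv_add_uminus)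

lemma f_inf_branch_hgrad_norm_sq:
  assumes "c \<noteq> 0" "open U" "(a, b) \<notin> U" "f_inf_branch a b c n L U f" "q \<in> U"
  shows "hgrad_norm_sq a c n f q = of_real (f_hgrad_norm_sq a b c n L q)"
proof -
  define s t A P where "s = g_exponent n L" and "t = h_exponent n L"
    and "A = real (n + 1) * c * (fst q - a) ^ n" and "P = g_norm_sq a b c n q"
  let ?g = "g_fun a b c n q"
  have q: "q \<noteq> (a, b)" using assms by auto
  have P: "P > 0" using assms q by (simp add: P_def g_norm_sq_pos)
  have g: "?g \<noteq> 0" using assms q by (simp add: g_fun_eq_0_iff)
  have gP: "?g * cnj ?g = of_real P"
    using g_fun_times_h_fun[of a b c n q] by (simp add: h_fun_eq_cnj P_def)
  have "norm ?g = sqrt P"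
    using norm_g_fun_sq[of a b c n q] by (metis P_def norm_ge_zero real_sqrt_unique)
  then have "norm (f q) = sqrt P powr (1 / real (n + 1))"
    using assms norm_f_inf_value[of "f q" a b c n L q] by (simp add: f_inf_branch_def)
  then have "(norm (f q))\<^sup>2 = P powr (1 / real (n + 1))"
    using P by (simp add: powr_mult[symmetric] power2_eq_square)
  then have ff: "f q * cnj (f q) = of_real (P powr (1 / real (n + 1)))"
    by (simp only: complex_norm_square[symmetric])
  have "hgrad_norm_sq a c n f q = (f q * cnj (f q)) * (of_real A)\<^sup>2 *
     ((s / ?g + t / cnj ?g) * (s / cnj ?g + t / ?g) + (s / ?g - t / cnj ?g) * (s / cnj ?g - t / ?g))"
    unfolding hgrad_norm_sq_def hgrad_def fst_conv snd_conv
      f_inf_branch_Y1[OF assms] f_inf_branch_Y2[OF assms] h_fun_eq_cnj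
      s_def[symmetric] t_def[symmetric] A_def[symmetric]
    by (simp add: power2_eq_square algebra_simps)
  \<comment> \<open>The mixed terms with \<open>s * t\<close> have opposite signs in the two
    products and cancel.\<close>
  also have "\<dots> = (f q * cnj (f q)) * (of_real A)\<^sup>2 * (2 * (s\<^sup>2 + t\<^sup>2) / (?g * cnj ?g))"
    using g by (simp add: field_simps power2_eq_square)
  also have "\<dots> = of_real (2 * (s\<^sup>2 + t\<^sup>2) * A\<^sup>2 * (P powr (1 / real (n + 1)) / P))"
    by (simp add: ff gP)
  also have "P powr (1 / real (n + 1)) / P = P powr (1 / real (n + 1) - 1)"
    using P by (simp add: powr_diff)
  also have "2 * (s\<^sup>2 + t\<^sup>2) * A\<^sup>2 * P powr (1 / real (n + 1) - 1) = f_hgrad_norm_sq a b c n L q"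
    by (simp add: f_hgrad_norm_sq_def A_def P_def s_def t_def power_mult_distrib power_mult mult.commute)
  finally show ?thesis .
qed

text \<open>The factor \<open>K\<close> factors out of the equation, which only sees the direction of this derivative.\<close>
lemma has_derivative_f_hgrad_norm_sq:
  assumes "c \<noteq> 0" "q \<noteq> (a, b)"
  shows "\<exists>K. (f_hgrad_norm_sq a b c n L has_derivative (\<lambda>v. K * real n * (fst q - a) ^ (2 * n - 1) *
    (real (n + 1) * (snd q - b)\<^sup>2 * fst v - (fst q - a) * (snd q - b) * snd v))) (at q)"
proof -
  define C where "C = 2 * ((g_exponent n L)\<^sup>2 + (h_exponent n L)\<^sup>2) * (real (n + 1) * c)\<^sup>2"
  define r where "r = 1 / real (n + 1) - 1"
  define X Y P where "X = fst q - a" and "Y = snd q - b" and "P = g_norm_sq a b c n q"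
  have P: "P > 0" using assms by (simp add: P_def g_norm_sq_pos)
  have X2: "X ^ (2 * n + 1) = X ^ (n + 1) * X ^ n"
    by (simp add: mult_2 power_add)
  have dP: "(g_norm_sq a b c n has_derivative (\<lambda>v. 2 * c\<^sup>2 * real (n + 1) * X ^ (2 * n + 1) * fst v
      + 2 * (real (n + 1))\<^sup>2 * Y * snd v)) (at q)"
    unfolding g_norm_sq_def X2 unfolding X_def Y_def
    by (rule derivative_eq_intros refl)+ (simp add: fun_eq_iff power2_eq_square algebra_simps)
  have dX: "((\<lambda>q. (fst q - a) ^ (2 * n)) has_derivative (\<lambda>v. real (2 * n) * fst v * X ^ (2 * n - 1))) (at q)"
    unfolding X_def by (rule derivative_eq_intros refl)+ (simp add: fun_eq_iff)
  have dr: "((\<lambda>x. x powr r) has_field_derivative r * P powr (r - 1)) (at P)"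
    using P by (auto intro!: derivative_eq_intros)
  have "((\<lambda>q. C * (fst q - a) ^ (2 * n) * g_norm_sq a b c n q powr r) has_derivative
     (\<lambda>v. C * X ^ (2 * n) * (r * P powr (r - 1) * (2 * c\<^sup>2 * real (n + 1) * X ^ (2 * n + 1) * fst v
        + 2 * (real (n + 1))\<^sup>2 * Y * snd v)) + C * (real (2 * n) * fst v * X ^ (2 * n - 1)) * P powr r)) (at q)"
    using has_derivative_mult[OF has_derivative_mult_right[OF dX, of C]
        has_derivative_compose[OF dP dr[unfolded has_field_derivative_def P_def]]]
    by (simp add: X_def P_def)
  moreover have "C * X ^ (2 * n) * (r * P powr (r - 1) * (2 * c\<^sup>2 * real (n + 1) * X ^ (2 * n + 1) * x
        + 2 * (real (n + 1))\<^sup>2 * Y * y)) + C * (real (2 * n) * x * X ^ (2 * n - 1)) * P powr r =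
      (2 * C * P powr (r - 1) * real (n + 1)) * real n * X ^ (2 * n - 1) *
      (real (n + 1) * Y\<^sup>2 * x - X * Y * y)" for x y
  proof -
    define Z Q where "Z = X ^ (2 * n - 1)" and "Q = P powr (r - 1)"
    have Q: "P powr r = Q * P"
      using P by (simp add: Q_def powr_diff)
    have r: "r * real (n + 1) = - real n"
      by (simp add: r_def field_simps)
    show ?thesis
    \<comment> \<open>For \<open>n = 0\<close> the exponent \<open>2 * n - 1\<close> is truncated to
      0, but both sides vanish: \<open>r = 0\<close>, and the other terms carry the factor
      \<open>n\<close>.\<close>
    proof (cases "n = 0")
      case True
      then show ?thesis using r by simp
    next
      case False
      have X: "X ^ (2 * n) = X * Z" "X ^ (2 * n + 1) = X\<^sup>2 * Z"
        using False by (cases n; simp add: Z_def power2_eq_square)+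
      have "P = c\<^sup>2 * (X\<^sup>2 * X ^ (2 * n)) + (real (n + 1))\<^sup>2 * Y\<^sup>2"
        by (simp add: P_def g_norm_sq_def X_def Y_def power_mult_distrib power_mult mult.commute[of 2 n])
      then have P: "P = c\<^sup>2 * (X ^ 3 * Z) + (real (n + 1))\<^sup>2 * Y\<^sup>2"
        unfolding X by (simp add: power2_eq_square power3_eq_cube mult.assoc)
      have "C * (X * Z) * (r * Q * (2 * c\<^sup>2 * real (n + 1) * (X\<^sup>2 * Z) * x + 2 * (real (n + 1))\<^sup>2 * Y * y))
          + C * (real (2 * n) * x * Z) * (Q * P) =
        2 * C * Q * Z * ((r * real (n + 1)) * (c\<^sup>2 * X ^ 3 * Z * x + real (n + 1) * X * Y * y) + real n * x * P)"
        by (simp add: algebra_simps power2_eq_square power3_eq_cube del: of_nat_Suc)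
      \<comment> \<open>With \<open>r * (n + 1) = - n\<close>, the terms in
        \<open>c\<^sup>2 * X ^ 3 * Z * x\<close> cancel against those coming from
        \<open>P\<close>.\<close>
      also have "\<dots> = (2 * C * Q * real (n + 1)) * real n * Z * (real (n + 1) * Y\<^sup>2 * x - X * Y * y)"
        unfolding r P by (simp add: algebra_simps power2_eq_square power3_eq_cube)
      finally show ?thesis
        unfolding X Q Q_def[symmetric] Z_def[symmetric] .
    qed
  qed
  ultimately show ?thesis
    unfolding f_hgrad_norm_sq_def C_def r_def X_def Y_def by auto
qed

text \<open>Over the common denominator \<open>g h\<close> the numerators are
  \<open>s h + t g\<close> and \<open>s h - t g\<close>. Their real and imaginary parts involve the
  exponents only through \<open>s + t = 1 / (n + 1)\<close> and
  \<open>t - s = n L / (n + 1)\<close>.\<close>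

lemma exponent_combinations:
  fixes a b c L :: real and q :: "real \<times> real" and n :: nat
  assumes "c \<noteq> 0" "q \<noteq> (a, b)"
  defines "u \<equiv> c * (fst q - a) ^ (n + 1)" and "Y \<equiv> snd q - b"
  shows "of_real (g_exponent n L) / g_fun a b c n q + of_real (h_exponent n L) / h_fun a b c n q =
      Complex (u / real (n + 1)) (real n * L * Y) / of_real (g_norm_sq a b c n q)" (is ?sum)
    and "of_real (g_exponent n L) / g_fun a b c n q - of_real (h_exponent n L) / h_fun a b c n q =
      Complex (- (real n * L * u / real (n + 1))) (- Y) / of_real (g_norm_sq a b c n q)" (is ?diff)
proof -
  let ?s = "g_exponent n L" and ?t = "h_exponent n L" and ?N = "real (n + 1)"
  have nz: "g_fun a b c n q \<noteq> 0" "h_fun a b c n q \<noteq> 0"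
    using assms by (simp_all add: g_fun_eq_0_iff h_fun_eq_0_iff)
  have gh: "g_fun a b c n q = Complex u (?N * Y)" "h_fun a b c n q = Complex u (- (?N * Y))"
    by (simp_all add: g_fun_def h_fun_def u_def Y_def complex_eq_iff)
  have st: "(?s + ?t) * ?N = 1" "(?t - ?s) * ?N = real n * L"
    unfolding g_exponent_plus_h_exponent h_exponent_minus_g_exponent by simp_all
  have "?s * h_fun a b c n q + ?t * g_fun a b c n q = Complex ((?s + ?t) * u) ((?t - ?s) * ?N * Y)"
    unfolding gh by (simp add: complex_eq_iff algebra_simps)
  then have 1: "?s * h_fun a b c n q + ?t * g_fun a b c n q = Complex (u / ?N) (real n * L * Y)"
    unfolding st g_exponent_plus_h_exponent by simp
  have "?s * h_fun a b c n q - ?t * g_fun a b c n q =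
      Complex (- ((?t - ?s) * u)) (- ((?s + ?t) * ?N * Y))"
    unfolding gh by (simp add: complex_eq_iff algebra_simps)
  then have 2: "?s * h_fun a b c n q - ?t * g_fun a b c n q = Complex (- (real n * L * u / ?N)) (- Y)"
    unfolding st h_exponent_minus_g_exponent by simp
  show ?sum ?diff
    unfolding 1[symmetric] 2[symmetric] g_fun_times_h_fun[symmetric]
    using nz by (simp_all add: field_simps)
qed

lemma f_inf_branch_G_inf:
  assumes "c \<noteq> 0" "open U" "(a, b) \<notin> U" "f_inf_branch a b c n L U f" "q \<in> U"
  shows "G_inf a c n L f q = 0"
proof -
  have q: "q \<noteq> (a, b)" using assms by auto
  define X Y P N where "X = fst q - a" and "Y = snd q - b" and "P = g_norm_sq a b c n q"
    and "N = real (n + 1)"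
  have pos: "P > 0" "N > 0"
    using assms(1) q by (simp_all add: P_def N_def g_norm_sq_pos)
  obtain K where K: "(f_hgrad_norm_sq a b c n L has_derivative (\<lambda>v. K * real n * X ^ (2 * n - 1) *
    (N * Y\<^sup>2 * fst v - X * Y * snd v))) (at q)"
    using has_derivative_f_hgrad_norm_sq[OF assms(1) q] unfolding X_def Y_def N_def by blast
  define k where "k = K * real n * X ^ (2 * n - 1)"
  have "(hgrad_norm_sq a c n f has_derivative (\<lambda>v. of_real (k * (N * Y\<^sup>2 * fst v - X * Y * snd v)))) (at q)"
    using has_derivative_of_real[OF K[folded k_def]] assms(2,5)
  proof (rule has_derivative_transform_within_open)
    show "complex_of_real (f_hgrad_norm_sq a b c n L x) = hgrad_norm_sq a c n f x" if "x \<in> U" for x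
      using f_inf_branch_hgrad_norm_sq[OF assms(1-4) that] by simp
  qed
  note D = vf_apply_eq[OF this]
  have 1: "vf_apply Y1 (hgrad_norm_sq a c n f) q = of_real (k * N * Y\<^sup>2)"
    unfolding D by (simp add: Y1_def)
  have 2: "vf_apply (Y2 a c n) (hgrad_norm_sq a c n f) q = of_real (- (k * Y * (c * (X * X ^ n))))"
    unfolding D by (simp add: Y2_def X_def)
  \<comment> \<open>The factor \<open>X\<close> in the derivative raises \<open>X ^ (n - 1)\<close>
    to \<open>X ^ n\<close>; for \<open>n = 0\<close> the factor \<open>n\<close> makes both sides
    0.\<close>
  have 3: "vf_apply (lie_bracket Y1 (Y2 a c n)) (hgrad_norm_sq a c n f) q =
      of_real (- (k * Y * (c * real n * X ^ n)))"
    unfolding D lie_bracket_Y1_Y2 by (cases n) (simp_all add: X_def)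
  define u where "u = c * (X * X ^ n)"
  have P: "P = u\<^sup>2 + (N * Y)\<^sup>2"
    by (simp add: P_def g_norm_sq_def u_def N_def X_def Y_def)
  \<comment> \<open>\<open>B\<close> is what remains of the infinity-Laplacian after
    \<open>k\<close>, \<open>f q\<close>, \<open>N * c * X ^ n\<close> and \<open>1 / P\<close> are
    taken out. Its real part cancels, and its imaginary part is a multiple of \<open>P\<close>,
    which removes the denominator and leaves exactly the bracket term with opposite sign.\<close>
  define B where "B = Complex (N * Y\<^sup>2) 0 * Complex (u / N) (real n * L * Y) -
     Complex 0 (Y * u) * Complex (- (real n * L * u / N)) (- Y)"
  have "B = Complex 0 (real n * L * Y * P / N)"
    using pos by (simp add: B_def P complex_eq_iff field_simps power2_eq_square)
  then have B: "of_real (N * c * X ^ n) * B / of_real P = \<i> * of_real (L * Y * (c * real n * X ^ n))"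
    using pos by (simp add: complex_eq_iff)
  have "G_inf a c n L f q = of_real k * f q * (of_real (N * c * X ^ n) * B / of_real P) -
      of_real k * f q * (\<i> * of_real (L * Y * (c * real n * X ^ n)))"
    unfolding G_inf_def inf_Laplacian_def 1 2 3
      f_inf_branch_Y1[OF assms] f_inf_branch_Y2[OF assms] exponent_combinations[OF assms(1) q]
      P_def[symmetric] X_def[symmetric] Y_def[symmetric] N_def[symmetric] power_add power_one_right
      mult.commute[of "X ^ n" X] u_def[symmetric]
    by (simp add: B_def Complex_eq divide_inverse algebra_simps)
  also have "\<dots> = 0" unfolding B by simp
  finally show ?thesis .
qed

section \<open>Existence of local and global determinations\<close>

text \<open>\<open>Ln (\<zeta> * z) - Ln \<zeta>\<close> is a logarithm of \<open>z\<close> whose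
  cut is rotated. Taking \<open>\<zeta> = 1\<close> gives the principal determination, and
  \<open>\<zeta> = c\<close> a global one for odd \<open>n\<close>.\<close>

lemma f_inf_branch_rotated:
  assumes "\<zeta> \<noteq> 0"
    and "\<And>q. q \<in> S \<Longrightarrow> \<zeta> * g_fun a b c n q \<notin> \<real>\<^sub>\<le>\<^sub>0" "\<And>q. q \<in> S \<Longrightarrow> \<zeta> * h_fun a b c n q \<notin> \<real>\<^sub>\<le>\<^sub>0"
  shows "f_inf_branch a b c n L S (\<lambda>q.
     exp (of_real (g_exponent n L) * (Ln (\<zeta> * g_fun a b c n q) - Ln \<zeta>)) *
     exp (of_real (h_exponent n L) * (Ln (\<zeta> * h_fun a b c n q) - Ln \<zeta>)))"
  unfolding f_inf_branch_def
proof (intro conjI ballI)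
  show "continuous_on S (\<lambda>q.
     exp (of_real (g_exponent n L) * (Ln (\<zeta> * g_fun a b c n q) - Ln \<zeta>)) *
     exp (of_real (h_exponent n L) * (Ln (\<zeta> * h_fun a b c n q) - Ln \<zeta>)))"
    using assms(2,3) by (intro continuous_intros continuous_on_g_fun continuous_on_h_fun) auto
  fix q assume q: "q \<in> S"
  have "exp (Ln (\<zeta> * g_fun a b c n q) - Ln \<zeta>) = g_fun a b c n q"
    using assms(1) assms(2)[OF q] by (cases "g_fun a b c n q = 0") (auto simp: exp_diff)
  moreover have "exp (Ln (\<zeta> * h_fun a b c n q) - Ln \<zeta>) = h_fun a b c n q"
    using assms(1) assms(3)[OF q] by (cases "h_fun a b c n q = 0") (auto simp: exp_diff)
  ultimately show "exp (of_real (g_exponent n L) * (Ln (\<zeta> * g_fun a b c n q) - Ln \<zeta>)) *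
     exp (of_real (h_exponent n L) * (Ln (\<zeta> * h_fun a b c n q) - Ln \<zeta>)) \<in> f_inf_values a b c n L q"
    unfolding f_inf_values_def power_values_def by blast
qed

lemma f_inf_branch_cong:
  assumes "f_inf_branch a b c n L S f" "\<And>q. q \<in> S \<Longrightarrow> f q = f' q"
  shows "f_inf_branch a b c n L S f'"
  using assms continuous_on_cong[OF refl assms(2)] by (simp add: f_inf_branch_def)

lemma f_inf_branch_principal:
  "f_inf_branch a b c n L {q. g_fun a b c n q \<notin> \<real>\<^sub>\<le>\<^sub>0} (f_inf a b c n L)"
proof -
  let ?S = "{q. g_fun a b c n q \<notin> \<real>\<^sub>\<le>\<^sub>0}"
  have "f_inf_branch a b c n L ?S (\<lambda>q.
     exp (of_real (g_exponent n L) * (Ln (1 * g_fun a b c n q) - Ln 1)) *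
     exp (of_real (h_exponent n L) * (Ln (1 * h_fun a b c n q) - Ln 1)))"
    by (intro f_inf_branch_rotated) (auto simp: h_fun_eq_cnj cnj_nonpos_Reals_iff)
  moreover have "exp (of_real (g_exponent n L) * (Ln (1 * g_fun a b c n q) - Ln 1)) *
     exp (of_real (h_exponent n L) * (Ln (1 * h_fun a b c n q) - Ln 1)) = f_inf a b c n L q"
    if "q \<in> ?S" for q
    using that by (cases "g_fun a b c n q = 0") (auto simp: f_inf_def powr_def h_fun_eq_cnj)
  ultimately show ?thesis
    by (rule f_inf_branch_cong)
qed

lemma f_inf_values_nonempty:
  assumes "c \<noteq> 0" "q \<noteq> (a, b)"
  shows "f_inf_values a b c n L q \<noteq> {}"
proof -
  have "exp (Ln (g_fun a b c n q)) = g_fun a b c n q" "exp (Ln (h_fun a b c n q)) = h_fun a b c n q"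
    using assms by (simp_all add: g_fun_eq_0_iff h_fun_eq_0_iff)
  then show ?thesis
    unfolding f_inf_values_def power_values_def by blast
qed

lemma f_inf_branch_local_exists:
  assumes "c \<noteq> 0" "p \<noteq> (a, b)" "z \<in> f_inf_values a b c n L p"
  shows "\<exists>U f. open U \<and> p \<in> U \<and> (a, b) \<notin> U \<and> f_inf_branch a b c n L U f \<and> f p = z"
proof -
  let ?U = "local_dom a b c n p" and ?f = "\<lambda>q. z * local_branch a b c n L p q"
  have U: "open ?U" "p \<in> ?U" "?f p = z"
    using assms by (simp_all add: open_local_dom center_in_local_dom local_branch_center)
  have ab: "(a, b) \<notin> ?U"
    using assms(1) by (rule singular_notin_local_dom)
  then have "f_inf_branch a b c n L ?U ?f"
    unfolding f_inf_branch_def using assms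
    by (auto intro!: continuous_intros continuous_on_local_branch local_branch_times_value)
  with U ab show ?thesis by blast
qed

text \<open>For odd \<open>n\<close> the power \<open>X ^ (n + 1)\<close> is nonnegative, so
  \<open>c * g\<close> stays in the closed right half-plane and vanishes only at
  \<open>(a, b)\<close>. Hence it never meets the cut of \<open>Ln\<close> elsewhere, and neither
  does its conjugate \<open>c * h\<close>.\<close>

lemma f_inf_branch_global_odd:
  assumes c: "c \<noteq> 0" and n: "odd n"
  shows "\<exists>f. f_inf_branch a b c n L (UNIV - {(a, b)}) f"
proof -
  have g: "of_real c * g_fun a b c n q \<notin> \<real>\<^sub>\<le>\<^sub>0" if "q \<noteq> (a, b)" for q
  proof
    assume "of_real c * g_fun a b c n q \<in> \<real>\<^sub>\<le>\<^sub>0"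
    then have *: "c * (c * (fst q - a) ^ (n + 1)) \<le> 0" "c * (real (n + 1) * (snd q - b)) = 0"
      by (simp_all add: complex_nonpos_Reals_iff g_fun_def)
    have "(fst q - a) ^ (n + 1) \<ge> 0" using n by (intro zero_le_even_power) simp
    moreover have "c * c > 0" using c not_real_square_gt_zero by blast
    ultimately have "(fst q - a) ^ (n + 1) = 0"
      using *(1) mult_pos_pos[of "c * c" "(fst q - a) ^ (n + 1)"] unfolding mult.assoc by linarith
    then have "fst q = a" "snd q = b" using *(2) c by auto
    then show False using that by (simp add: prod_eq_iff)
  qed
  then have h: "of_real c * h_fun a b c n q \<notin> \<real>\<^sub>\<le>\<^sub>0" if "q \<noteq> (a, b)" for q
    using that cnj_nonpos_Reals_iff[of "of_real c * g_fun a b c n q"] by (simp add: h_fun_eq_cnj)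
  show ?thesis
    by (rule exI, rule f_inf_branch_rotated[of "of_real c"]) (use c g h in auto)
qed

text \<open>For a logarithm \<open>w\<close> of \<open>g\<close> and exponents \<open>s\<close>, \<open>t\<close> one has
  \<open>s w + t cnj w = (s - t) w + 2 t Re w\<close>, and the power of \<open>g\<close> with integer exponent \<open>s - t = - k\<close>
  does not depend on the choice of \<open>w\<close>.\<close>
lemma f_inf_branch_global_integer:
  assumes c: "c \<noteq> 0" and k: "real n * L / real (n + 1) = of_int k"
  shows "f_inf_branch a b c n L (UNIV - {(a, b)})
    (\<lambda>q. g_fun a b c n q powi (- k) * of_real (norm (g_fun a b c n q) powr (2 * h_exponent n L)))"
  unfolding f_inf_branch_def
proof (intro conjI ballI)
  let ?g = "g_fun a b c n" and ?s = "g_exponent n L" and ?t = "h_exponent n L"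
  show "continuous_on (UNIV - {(a, b)}) (\<lambda>q. ?g q powi (- k) * of_real (norm (?g q) powr (2 * ?t)))"
    using c by (intro continuous_intros continuous_on_g_fun) (auto simp: g_fun_eq_0_iff)
  fix q assume "q \<in> UNIV - {(a, b)}"
  then have g: "?g q \<noteq> 0" using c by (simp add: g_fun_eq_0_iff)
  define w where "w = Ln (?g q)"
  have w: "exp w = ?g q" "exp (cnj w) = h_fun a b c n q"
    using g by (simp_all add: w_def h_fun_eq_cnj flip: exp_cnj)
  have st: "?s = ?t + of_int (- k)"
    using h_exponent_minus_g_exponent[of n L] k by simp
  have "?s * w + ?t * cnj w = of_int (- k) * w + of_real (2 * ?t * Re w)"
    unfolding st by (simp add: complex_eq_iff algebra_simps)
  then have "exp (?s * w) * exp (?t * cnj w) = exp (of_int (- k) * w) * exp (of_real (2 * ?t * Re w))"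
    by (simp only: exp_add[symmetric])
  also have "exp (of_int (- k) * w) = ?g q powi (- k)"
    by (simp only: w(1)[symmetric] exp_power_int)
  also have "exp (of_real (2 * ?t * Re w)) = complex_of_real (norm (?g q) powr (2 * ?t))"
    using g by (simp add: powr_def w_def flip: exp_of_real)
  finally show "?g q powi (- k) * of_real (norm (?g q) powr (2 * ?t)) \<in> f_inf_values a b c n L q"
    using w unfolding f_inf_values_def power_values_def by (metis (mono_tags, lifting) mem_Collect_eq)
qed



theorem theorem6p2:
  fixes a b c L :: real and n :: nat
  assumes "c \<noteq> 0"
  shows
    "(\<forall>U f. open U \<and> (a, b) \<notin> U \<and> f_inf_branch a b c n L U f \<longrightarrow>
        smooth_on f U \<and>
        (\<forall>q\<in>U. G_inf a c n L f q = 0) \<and>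
        (f \<longlongrightarrow> 0) (at (a, b) within U)) \<and>
     f_inf_branch a b c n L {q. g_fun a b c n q \<notin> \<real>\<^sub>\<le>\<^sub>0} (f_inf a b c n L) \<and>
     (\<forall>q. q \<noteq> (a, b) \<longrightarrow> f_inf_values a b c n L q \<noteq> {} \<and>
        (\<forall>z \<in> f_inf_values a b c n L q.
           \<exists>U f. open U \<and> q \<in> U \<and> (a, b) \<notin> U \<and> f_inf_branch a b c n L U f \<and> f q = z)) \<and>
     (odd n \<or> real n * L / real (n + 1) \<in> \<int> \<longrightarrow>
        (\<exists>f. f_inf_branch a b c n L (UNIV - {(a, b)}) f))"
proof (intro conjI allI impI)
  fix U f assume "open U \<and> (a, b) \<notin> U \<and> f_inf_branch a b c n L U f"
  then have U: "open U" "(a, b) \<notin> U" and f: "f_inf_branch a b c n L U f" by simp_all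
  show "smooth_on f U"
    using assms U f by (rule f_inf_branch_smooth)
  show "\<forall>q\<in>U. G_inf a c n L f q = 0"
    using f_inf_branch_G_inf[OF assms U f] by simp
  show "(f \<longlongrightarrow> 0) (at (a, b) within U)"
    using f by (rule f_inf_branch_tendsto_0)
next
  show "f_inf_branch a b c n L {q. g_fun a b c n q \<notin> \<real>\<^sub>\<le>\<^sub>0} (f_inf a b c n L)"
    by (rule f_inf_branch_principal)
next
  fix q assume q: "q \<noteq> (a, b)"
  show "f_inf_values a b c n L q \<noteq> {}"
    using assms q by (rule f_inf_values_nonempty)
  show "\<forall>z \<in> f_inf_values a b c n L q.
      \<exists>U f. open U \<and> q \<in> U \<and> (a, b) \<notin> U \<and> f_inf_branch a b c n L U f \<and> f q = z"
    by (rule ballI, rule f_inf_branch_local_exists[OF assms q])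
next
  assume "odd n \<or> real n * L / real (n + 1) \<in> \<int>"
  then show "\<exists>f. f_inf_branch a b c n L (UNIV - {(a, b)}) f"
  proof
    assume "odd n"
    with assms show ?thesis by (rule f_inf_branch_global_odd)
  next
    assume "real n * L / real (n + 1) \<in> \<int>"
    then obtain k where k: "real n * L / real (n + 1) = of_int k" by (rule Ints_cases)
    show ?thesis by (rule exI, rule f_inf_branch_global_integer[OF assms k])
  qed
qed

end
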